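(* For every graph $G$ with minimum degree $\delta(G)\ge 1$ and independence number $\alpha(G)\ge 2$, $$f_o(G)\ \ge\ \frac{\alpha(G)}{2}+\frac{\log_3(\alpha(G))}{8}-\frac{\log_3\log_3\bigl(\sqrt{\alpha(G)}\bigr)}{4}.$$
   Context: All graphs are finite and simple (no loops, no multiple edges). $f_o(G)$ denotes the maximum size of a set $S\subseteq V(G)$ such that every vertex of the induced subgraph $G[S]$ has odd degree in $G[S]$ (the empty set is vacuously allowed). $\alpha(G)$ is the maximum size of an independent set of $G$. *)

theory Defs
  imports Complex_Main "Graph_Theory.Graph_Theory"
begin

(* A finite simple graph is a digraph satisfying the library locale "graph": finite, loopless,
   without parallel arcs, and symmetric. Each undirected edge is a pair of opposite arcs, so the
   degree of v is its out-degree, which counts the neighbours of v once each. *)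

(* Meaningful only if the vertex set is nonempty, since Min {} is unspecified. *)
definition min_degree :: "('a, 'b) pre_digraph \<Rightarrow> nat" where
  "min_degree G = Min (out_degree G ` verts G)"

definition independent_set :: "('a, 'b) pre_digraph \<Rightarrow> 'a set \<Rightarrow> bool" where
  "independent_set G S \<longleftrightarrow> S \<subseteq> verts G \<and> (\<forall>u\<in>S. \<forall>v\<in>S. \<not> u \<rightarrow>\<^bsub>G\<^esub> v)"

definition independence_number :: "('a, 'b) pre_digraph \<Rightarrow> nat" where
  "independence_number G = Max {card S |S. independent_set G S}"

definition odd_induced :: "('a, 'b) pre_digraph \<Rightarrow> 'a set \<Rightarrow> bool" where
  "odd_induced G S \<longleftrightarrow> S \<subseteq> verts G \<and> (\<forall>v\<in>S. odd (out_degree (G \<restriction> S) v))"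

definition f_odd :: "('a, 'b) pre_digraph \<Rightarrow> nat" where
  "f_odd G = Max {card S |S. odd_induced G S}"

end

(*
  Let I be a maximum independent set, a = |I|, and let D be a minimal set of vertices outside I
  dominating I, k = |D|. By minimality every d in D has a private neighbour p d in I. For
  A \<subseteq> D and J \<subseteq> I containing the private neighbours, take A together with the vertices of J
  that have an odd number of neighbours in A; dropping p d for each d in A of even degree makes
  all degrees odd. So f_o is at least the number of odd vertices of J plus the number of d in A
  of odd degree, and this is averaged over families of sets A.

  Averaging over all nonempty A gives f_o (2^k - 1) \<ge> 2^(k-1) a, which suffices if k is small.
  For large k, f_o \<ge> a/2 + k/12 suffices. Over F_2 the degree parity of d \<in> A is an affine
  function of the other elements of A; if some coefficient (the coupling of d with another
  vertex of D) is odd, then d lies in A with odd degree in a quarter of all cases. The set B of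
  those d without an odd coupling is treated by deleting from I a greedily chosen set U, each
  vertex of which covers at least four new elements of B: this costs |U|/2 and gives an odd
  coupling to each of the covered elements, of which there are at least 4|U|. A vertex in I
  then has at most three neighbours in the uncovered part of B, which is split into a maximal
  disjoint family P of pairs that are exact neighbourhoods of vertices of I, and the rest W.
  Letting A contain W makes every vertex with neighbourhood inside W odd, and letting A meet each
  pair of P in one point makes the vertices defining P odd; the two choices gain |W|/2 and |P|/2.
*)
theory Submission
  imports Defs
begin

section \<open>Parity of symmetric differences and counting by an involution\<close>

lemma even_card_sym_diff:
  assumes "finite A" "finite B"
  shows "even (card (sym_diff A B)) \<longleftrightarrow> (even (card A) \<longleftrightarrow> even (card B))"
proof -
  have "card (sym_diff A B) = card (A - B) + card (B - A)"
    using assms by (intro card_Un_disjoint) auto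
  moreover have "card A = card (A - B) + card (A \<inter> B)"
    using assms by (subst card_Un_disjoint [symmetric]) (auto intro: arg_cong [where f = card])
  moreover have "card B = card (B - A) + card (A \<inter> B)"
    using assms by (subst card_Un_disjoint [symmetric]) (auto intro: arg_cong [where f = card])
  ultimately show ?thesis
    by presburger
qed

text \<open>Symmetric difference with \<open>T\<close> is an involution on \<open>F\<close> that
  exchanges the members satisfying \<open>P\<close> with the others. Every exact count of a half or
  a quarter below comes from this.\<close>

lemma double_card_filter_toggle:
  assumes "finite F"
    and closed: "\<And>A. A \<in> F \<Longrightarrow> sym_diff A T \<in> F"
    and flip: "\<And>A. A \<in> F \<Longrightarrow> P (sym_diff A T) \<longleftrightarrow> \<not> P A"
  shows "2 * card {A \<in> F. P A} = card F"
proof -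
  have inv: "sym_diff (sym_diff A T) T = A" for A
    by auto
  have "bij_betw (\<lambda>A. sym_diff A T) {A \<in> F. P A} {A \<in> F. \<not> P A}"
    by (rule bij_betwI [where g = "\<lambda>A. sym_diff A T"]) (use closed flip inv in auto)
  then have "card {A \<in> F. P A} = card {A \<in> F. \<not> P A}"
    by (rule bij_betw_same_card)
  moreover have "card F = card {A \<in> F. P A} + card {A \<in> F. \<not> P A}"
    using \<open>finite F\<close>
    by (subst card_Un_disjoint [symmetric]) (auto intro: arg_cong [where f = card])
  ultimately show ?thesis
    by simp
qed

section \<open>Dominating sets with private neighbours and the odd sets built from them\<close>

text \<open>Here \<open>f\<close> is any upper bound for the odd sets inside
  \<open>D \<union> I\<close>; no maximality and no edge outside this set enters the
  argument.\<close>

locale private_domination =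
  fixes adj :: "'a \<Rightarrow> 'a \<Rightarrow> bool" and D I :: "'a set" and p :: "'a \<Rightarrow> 'a" and f :: nat
  assumes finite_D: "finite D" and finite_I: "finite I" and disjoint: "D \<inter> I = {}"
    and adj_sym: "adj u v \<Longrightarrow> adj v u"
    and independent: "u \<in> I \<Longrightarrow> v \<in> I \<Longrightarrow> \<not> adj u v"
    and dominated: "v \<in> I \<Longrightarrow> \<exists>d\<in>D. adj v d"
    and private_in: "d \<in> D \<Longrightarrow> p d \<in> I"
    and private_nbs: "d \<in> D \<Longrightarrow> {x \<in> D. adj (p d) x} = {d}"
    and bound: "S \<subseteq> D \<union> I \<Longrightarrow> (\<And>v. v \<in> S \<Longrightarrow> odd (card {w \<in> S. adj v w})) \<Longrightarrow> card S \<le> f"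
begin

definition nb :: "'a \<Rightarrow> 'a set" where
  "nb v = {d \<in> D. adj v d}"

definition active :: "'a set \<Rightarrow> 'a set \<Rightarrow> 'a set" where
  "active J A = {v \<in> J. odd (card (nb v \<inter> A))}"

text \<open>For \<open>d\<close> in \<open>A\<close> this is the degree before any private
  neighbours are dropped.\<close>

definition deg :: "'a set \<Rightarrow> 'a set \<Rightarrow> 'a \<Rightarrow> nat" where
  "deg J A d = card {w \<in> A \<union> active J A. adj d w}"

text \<open>Modulo 2 this is the change of \<open>deg J A d\<close> when \<open>a\<close> is toggled
  in \<open>A\<close>. It does not depend on \<open>A\<close>, which is what makes the degree parity
  affine over F_2.\<close>

definition coupling :: "'a set \<Rightarrow> 'a \<Rightarrow> 'a \<Rightarrow> nat" where
  "coupling J d a = card {v \<in> J. adj d v \<and> adj a v} + of_bool (adj d a)"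

text \<open>Over F_2, \<open>F\<close> is invariant under translation by \<open>T\<close>. The
  families used with it are affine subspaces, which avoids choosing bases.\<close>

definition toggle_closed :: "'a set set \<Rightarrow> 'a set \<Rightarrow> bool" where
  "toggle_closed F T \<longleftrightarrow> (\<forall>A\<in>F. sym_diff A T \<in> F)"

lemma nb_subset: "nb v \<subseteq> D"
  by (auto simp: nb_def)

lemma finite_nb: "finite (nb v)"
  using finite_subset [OF nb_subset finite_D] .

lemma nb_private: "d \<in> D \<Longrightarrow> nb (p d) = {d}"
  using private_nbs by (simp add: nb_def)

lemma nb_nonempty: "v \<in> I \<Longrightarrow> nb v \<noteq> {}"
  using dominated by (auto simp: nb_def)

lemma inj_private: "inj_on p D"
  by (metis inj_onI nb_private singleton_inject)

lemma in_nb_iff: "d \<in> D \<Longrightarrow> d \<in> nb v \<longleftrightarrow> adj d v"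
  using adj_sym by (auto simp: nb_def)

text \<open>A vertex of \<open>I\<close> in the set sees only \<open>A\<close>, since
  \<open>I\<close> is independent. Dropping \<open>p d\<close> changes no degree in \<open>A\<close>
  but that of \<open>d\<close>, because \<open>d\<close> is the only neighbour of \<open>p d\<close>
  in \<open>D\<close>. Each element of even degree thus costs one vertex, so \<open>A\<close> still
  contributes its elements of odd degree.\<close>

lemma odd_set_size:
  assumes A: "A \<subseteq> D" and J: "J \<subseteq> I" "p ` D \<subseteq> J"
  shows "card (active J A) + card {d \<in> A. odd (deg J A d)} \<le> f"
proof -
  define Q where "Q = {d \<in> A. even (deg J A d)}"
  define S where "S = A \<union> (active J A - p ` Q)"
  have QA: "Q \<subseteq> A" and finA: "finite A"
    using A finite_D by (auto simp: Q_def intro: finite_subset)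
  have act_I: "active J A \<subseteq> I"
    using J by (auto simp: active_def)
  have fin_act: "finite (active J A)"
    using act_I finite_I finite_subset by auto
  have p_act: "p d \<in> active J A" if "d \<in> A" for d
  proof -
    have "d \<in> D" "p d \<in> J"
      using that A J by auto
    then show ?thesis
      using that nb_private by (simp add: active_def)
  qed
  have adj_p: "adj d (p d') \<longleftrightarrow> d = d'" if "d \<in> D" "d' \<in> D" for d d'
    using in_nb_iff [of d "p d'"] nb_private [of d'] that by auto
  have "odd (card {w \<in> S. adj v w})" if v: "v \<in> S" for v
  proof (cases "v \<in> A")
    case False
    with v have v_act: "v \<in> active J A" "v \<in> I"
      using act_I by (auto simp: S_def)
    then have "{w \<in> S. adj v w} = nb v \<inter> A"
      using A act_I independent by (auto simp: S_def nb_def)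
    with v_act show ?thesis
      by (simp add: active_def)
  next
    case True
    then have vD: "v \<in> D"
      using A by auto
    have "p ` Q \<inter> A = {}"
      using A J disjoint QA by blast
    then have "{w \<in> S. adj v w} = {w \<in> A \<union> active J A. adj v w} - {w \<in> p ` Q. adj v w}"
      by (auto simp: S_def)
    moreover have "{w \<in> p ` Q. adj v w} = (if v \<in> Q then {p v} else {})"
      using adj_p vD QA A by auto
    ultimately have eq: "{w \<in> S. adj v w} =
        {w \<in> A \<union> active J A. adj v w} - (if v \<in> Q then {p v} else {})"
      by simp
    show ?thesis
    proof (cases "v \<in> Q")
      case True
      have fin: "finite {w \<in> A \<union> active J A. adj v w}"
        using finA fin_act by auto
      have mem: "p v \<in> {w \<in> A \<union> active J A. adj v w}"
        using p_act \<open>v \<in> A\<close> adj_p vD by auto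
      have "card {w \<in> S. adj v w} = deg J A v - 1"
        unfolding eq deg_def using True mem fin by simp
      moreover have "deg J A v > 0"
        unfolding deg_def using mem fin card_gt_0_iff by blast
      moreover have "even (deg J A v)"
        using True by (simp add: Q_def)
      ultimately show ?thesis
        by simp
    next
      case False
      then show ?thesis
        using eq \<open>v \<in> A\<close> by (simp add: deg_def Q_def)
    qed
  qed
  moreover have "S \<subseteq> D \<union> I"
    using A act_I by (auto simp: S_def)
  ultimately have "card S \<le> f"
    using bound by blast
  moreover have "card S = card A + (card (active J A) - card Q)"
  proof -
    have "card S = card A + card (active J A - p ` Q)"
      unfolding S_def using A act_I disjoint finA fin_act
      by (intro card_Un_disjoint) auto
    also have "card (active J A - p ` Q) = card (active J A) - card (p ` Q)"
      using p_act QA finite_subset [OF QA finA] by (intro card_Diff_subset) auto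
    also have "card (p ` Q) = card Q"
      using inj_private QA A by (intro card_image) (meson inj_on_subset order_trans)
    finally show ?thesis .
  qed
  moreover have "card A = card Q + card {d \<in> A. odd (deg J A d)}"
    unfolding Q_def using finA
    by (subst card_Un_disjoint [symmetric]) (auto intro: arg_cong [where f = card])
  ultimately show ?thesis
    by linarith
qed

section \<open>Averaging over families of subsets of the dominating set\<close>

text \<open>Double counting turns the bound for each single \<open>A\<close> into one about each
  single vertex. Restricting to \<open>X\<close> allows counting only those \<open>d\<close> whose
  frequency is known.\<close>

lemma averaging:
  assumes F: "F \<subseteq> Pow D" and J: "J \<subseteq> I" "p ` D \<subseteq> J" and X: "X \<subseteq> D"
  shows "(\<Sum>v\<in>J. card {A \<in> F. odd (card (nb v \<inter> A))})
      + (\<Sum>d\<in>X. card {A \<in> F. d \<in> A \<and> odd (deg J A d)}) \<le> f * card F"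
proof -
  have fin: "finite F" "finite J" "finite X"
    using F J X finite_D finite_I by (auto intro: finite_subset)
  have "(\<Sum>v\<in>J. card {A \<in> F. odd (card (nb v \<inter> A))})
      = (\<Sum>A\<in>F. card {v \<in> J. odd (card (nb v \<inter> A))})"
    using fin by (intro sum_multicount_gen) auto
  moreover have "(\<Sum>d\<in>X. card {A \<in> F. d \<in> A \<and> odd (deg J A d)})
      = (\<Sum>A\<in>F. card {d \<in> X. d \<in> A \<and> odd (deg J A d)})"
    using fin by (intro sum_multicount_gen) auto
  moreover have "card {v \<in> J. odd (card (nb v \<inter> A))}
      + card {d \<in> X. d \<in> A \<and> odd (deg J A d)} \<le> f" if "A \<in> F" for A
  proof -
    have AD: "A \<subseteq> D"
      using that F by auto
    have "card {d \<in> X. d \<in> A \<and> odd (deg J A d)} \<le> card {d \<in> A. odd (deg J A d)}"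
      using AD finite_D by (intro card_mono) (auto intro: finite_subset)
    with odd_set_size [OF AD J] show ?thesis
      by (simp add: active_def)
  qed
  ultimately show ?thesis
    using sum_bounded_above [of F
        "\<lambda>A. card {v \<in> J. odd (card (nb v \<inter> A))} + card {d \<in> X. d \<in> A \<and> odd (deg J A d)}" f]
    by (simp add: sum.distrib mult.commute)
qed

lemma even_nb_toggle:
  assumes "finite A" "finite T"
  shows "even (card (nb v \<inter> sym_diff A T))
    \<longleftrightarrow> (even (card (nb v \<inter> A)) \<longleftrightarrow> even (card (nb v \<inter> T)))"
proof -
  have "nb v \<inter> sym_diff A T = sym_diff (nb v \<inter> A) (nb v \<inter> T)"
    by auto
  then show ?thesis
    using even_card_sym_diff [of "nb v \<inter> A" "nb v \<inter> T"] assms by simp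
qed

lemma odd_nb_half:
  assumes F: "F \<subseteq> Pow D" and T: "toggle_closed F T" "finite T" "odd (card (nb v \<inter> T))"
  shows "2 * card {A \<in> F. odd (card (nb v \<inter> A))} = card F"
proof (rule double_card_filter_toggle [where T = T])
  show "finite F"
    using F finite_D by (auto intro: finite_subset)
  show "sym_diff A T \<in> F" if "A \<in> F" for A
    using T that by (simp add: toggle_closed_def)
  show "odd (card (nb v \<inter> sym_diff A T)) \<longleftrightarrow> \<not> odd (card (nb v \<inter> A))" if "A \<in> F" for A
  proof -
    have "finite A"
      using that F finite_subset [OF _ finite_D] by auto
    then show ?thesis
      using even_nb_toggle [of A T v] T by auto
  qed
qed

lemma even_deg_toggle:
  assumes A: "A \<subseteq> D" and J: "J \<subseteq> I" and d: "d \<in> D" and a: "a \<in> D"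
  shows "even (deg J (sym_diff A {a}) d) \<longleftrightarrow> (even (deg J A d) \<longleftrightarrow> even (coupling J d a))"
proof -
  have finA: "finite A" and finJ: "finite J"
    using A J finite_D finite_I finite_subset by auto
  have act: "active J B \<subseteq> I" "finite (active J B)" for B
    using J finJ by (auto simp: active_def)
  have deg: "deg J B d = card {w \<in> B. adj d w} + card {v \<in> active J B. adj d v}"
    if B: "B \<subseteq> D" for B
  proof -
    have "finite B" "B \<inter> active J B = {}"
      using B act(1) [of B] disjoint finite_subset [OF _ finite_D] by blast+
    then show ?thesis
      unfolding deg_def using act
      by (subst card_Un_disjoint [symmetric]) (auto intro!: arg_cong [where f = card])
  qed
  have "even (card (nb v \<inter> {a})) \<longleftrightarrow> \<not> adj a v" for v
    using in_nb_iff [OF a, of v] by (auto simp: Int_insert_right)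
  \<comment> \<open>Toggling \<open>a\<close> flips the activity of exactly those vertices of
    \<open>J\<close> that are adjacent to \<open>a\<close>.\<close>
  then have "active J (sym_diff A {a}) = sym_diff (active J A) {v \<in> J. adj a v}"
    unfolding active_def using even_nb_toggle [OF finA, of "{a}"] by auto
  then have "{v \<in> active J (sym_diff A {a}). adj d v}
      = sym_diff {v \<in> active J A. adj d v} {v \<in> J. adj d v \<and> adj a v}"
    by auto
  then have 1: "even (card {v \<in> active J (sym_diff A {a}). adj d v}) \<longleftrightarrow>
      (even (card {v \<in> active J A. adj d v}) \<longleftrightarrow> even (card {v \<in> J. adj d v \<and> adj a v}))"
    using even_card_sym_diff [of "{v \<in> active J A. adj d v}" "{v \<in> J. adj d v \<and> adj a v}"]
      act finJ by simp
  have "{w \<in> sym_diff A {a}. adj d w} = sym_diff {w \<in> A. adj d w} (if adj d a then {a} else {})"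
    by auto
  then have 2: "even (card {w \<in> sym_diff A {a}. adj d w}) \<longleftrightarrow>
      (even (card {w \<in> A. adj d w}) \<longleftrightarrow> \<not> adj d a)"
    using even_card_sym_diff [of "{w \<in> A. adj d w}" "if adj d a then {a} else {}"] finA
    by (auto split: if_splits)
  have "sym_diff A {a} \<subseteq> D"
    using A a by auto
  then show ?thesis
    using 1 2 deg [of "sym_diff A {a}"] deg [OF A] unfolding coupling_def by auto
qed

text \<open>Two successive halvings: toggling \<open>d\<close> decides whether \<open>d\<close> lies
  in \<open>A\<close>; toggling \<open>a\<close>, which differs from \<open>d\<close>, preserves
  this and flips the degree parity.\<close>

lemma odd_deg_quarter:
  assumes F: "F \<subseteq> Pow D" and J: "J \<subseteq> I" and d: "d \<in> D" and a: "a \<in> D" "a \<noteq> d"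
    and cl: "toggle_closed F {d}" "toggle_closed F {a}" and odd: "odd (coupling J d a)"
  shows "4 * card {A \<in> F. d \<in> A \<and> odd (deg J A d)} = card F"
proof -
  have fin: "finite F"
    using F finite_D by (auto intro: finite_subset)
  have "2 * card {A \<in> F. d \<in> A} = card F"
    by (rule double_card_filter_toggle [where T = "{d}"])
      (use fin cl in \<open>auto simp: toggle_closed_def\<close>)
  moreover have "2 * card {A \<in> {A \<in> F. d \<in> A}. odd (deg J A d)} = card {A \<in> F. d \<in> A}"
  proof (rule double_card_filter_toggle [where T = "{a}"])
    show "odd (deg J (sym_diff A {a}) d) \<longleftrightarrow> \<not> odd (deg J A d)" if "A \<in> {A \<in> F. d \<in> A}" for A
      using even_deg_toggle [of A J d a] that F J d a odd by auto
  qed (use fin cl a in \<open>auto simp: toggle_closed_def\<close>)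
  moreover have "{A \<in> {A \<in> F. d \<in> A}. odd (deg J A d)} = {A \<in> F. d \<in> A \<and> odd (deg J A d)}"
    by auto
  ultimately show ?thesis
    by simp
qed

text \<open>In units of a quarter of \<open>card F\<close>, a vertex of \<open>I - U\<close> counts
  at least 2, one of \<open>K\<close> counts 4 since it is odd for every \<open>A\<close>, and an
  element of \<open>C\<close> counts 1. The set \<open>U\<close> avoids the private neighbours so
  that \<open>I - U\<close> is still admissible in \<open>averaging\<close>.\<close>

lemma averaging_bound:
  assumes F: "F \<subseteq> Pow D" "F \<noteq> {}" and U: "U \<subseteq> I" "U \<inter> p ` D = {}"
    and C: "C \<subseteq> D"
    and C_coupled: "\<And>d. d \<in> C \<Longrightarrow> toggle_closed F {d} \<and>
      (\<exists>a\<in>D - {d}. toggle_closed F {a} \<and> odd (coupling (I - U) d a))"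
    and half: "\<And>v. v \<in> I \<Longrightarrow> card F \<le> 2 * card {A \<in> F. odd (card (nb v \<inter> A))}"
    and K: "K \<subseteq> I - U" "\<And>v A. v \<in> K \<Longrightarrow> A \<in> F \<Longrightarrow> odd (card (nb v \<inter> A))"
  shows "2 * card I + 2 * card K + card C \<le> 4 * f + 2 * card U"
proof -
  define J where "J = I - U"
  define c where "c = card F"
  have fin: "finite F" "finite J" "finite K" "finite C" "finite U"
    using F U C K finite_D finite_I by (auto simp: J_def intro: finite_subset finite_subset [OF F(1)])
  have c: "c > 0"
    using F fin by (simp add: c_def card_gt_0_iff)
  have avg: "(\<Sum>v\<in>J. card {A \<in> F. odd (card (nb v \<inter> A))})
      + (\<Sum>d\<in>C. card {A \<in> F. d \<in> A \<and> odd (deg J A d)}) \<le> f * c"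
    unfolding c_def using F U C private_in by (intro averaging) (auto simp: J_def)
  have "4 * (\<Sum>d\<in>C. card {A \<in> F. d \<in> A \<and> odd (deg J A d)}) = (\<Sum>d\<in>C. c)"
    unfolding sum_distrib_left c_def
  proof (rule sum.cong)
    fix d assume d: "d \<in> C"
    then obtain a where "a \<in> D - {d}" "toggle_closed F {d}" "toggle_closed F {a}"
      "odd (coupling J d a)"
      using C_coupled unfolding J_def by blast
    with d C F show "4 * card {A \<in> F. d \<in> A \<and> odd (deg J A d)} = card F"
      by (intro odd_deg_quarter [of F J d a]) (auto simp: J_def)
  qed simp
  then have C_sum: "4 * (\<Sum>d\<in>C. card {A \<in> F. d \<in> A \<and> odd (deg J A d)}) = card C * c"
    by simp
  have "(\<Sum>v\<in>J. c + (if v \<in> K then c else 0))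
      \<le> (\<Sum>v\<in>J. 2 * card {A \<in> F. odd (card (nb v \<inter> A))})"
  proof (rule sum_mono)
    fix v assume v: "v \<in> J"
    show "c + (if v \<in> K then c else 0) \<le> 2 * card {A \<in> F. odd (card (nb v \<inter> A))}"
    proof (cases "v \<in> K")
      case True
      then have "{A \<in> F. odd (card (nb v \<inter> A))} = F"
        using K by auto
      with True show ?thesis
        by (simp add: c_def)
    next
      case False
      then show ?thesis
        using half v by (auto simp: c_def J_def)
    qed
  qed
  moreover have "J \<inter> K = K"
    using K by (auto simp: J_def)
  ultimately have "(card J + card K) * c \<le> 2 * (\<Sum>v\<in>J. card {A \<in> F. odd (card (nb v \<inter> A))})"
    using fin by (simp add: sum.distrib sum.If_cases sum_distrib_left algebra_simps)
  with avg C_sum have "(2 * (card J + card K) + card C) * c \<le> (4 * f) * c"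
    by (simp add: algebra_simps)
  with c have "2 * (card J + card K) + card C \<le> 4 * f"
    by simp
  moreover have "card J + card U = card I"
    using U fin finite_I by (simp add: J_def card_Diff_subset card_mono)
  ultimately show ?thesis
    by simp
qed

section \<open>Bounds from the full power set and from its nonempty members\<close>

lemma coupled_bound:
  "2 * card I + card {d \<in> D. \<exists>a\<in>D - {d}. odd (coupling I d a)} \<le> 4 * f"
proof -
  have cl: "toggle_closed (Pow D) {d}" if "d \<in> D" for d
    using that by (auto simp: toggle_closed_def)
  have "2 * card I + 2 * card ({} :: 'a set) + card {d \<in> D. \<exists>a\<in>D - {d}. odd (coupling I d a)}
      \<le> 4 * f + 2 * card ({} :: 'a set)"
  proof (rule averaging_bound [where F = "Pow D"])
    fix v assume "v \<in> I"
    then obtain d where "d \<in> nb v"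
      using nb_nonempty by auto
    then show "card (Pow D) \<le> 2 * card {A \<in> Pow D. odd (card (nb v \<inter> A))}"
      using odd_nb_half [of "Pow D" "{d}" v] cl [of d] nb_subset [of v] by auto
  qed (use cl in auto)
  then show ?thesis
    by simp
qed

text \<open>The empty set makes no vertex odd, so leaving it out keeps the count
  \<open>2 ^ (card D - 1)\<close> for each vertex of \<open>I\<close> while the family loses one
  member. This is the whole gain over \<open>card I / 2\<close>.\<close>

lemma few_dominators_bound:
  assumes "D \<noteq> {}"
  shows "card I * 2 ^ card D \<le> 2 * f * (2 ^ card D - 1)"
proof -
  define F where "F = Pow D - {{}}"
  have cF: "card F = 2 ^ card D - 1"
    using finite_D by (simp add: F_def card_Diff_singleton card_Pow)
  have half: "2 * card {A \<in> F. odd (card (nb v \<inter> A))} = 2 ^ card D" if v: "v \<in> I" for v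
  proof -
    obtain d where d: "d \<in> nb v" "d \<in> D"
      using nb_nonempty v nb_subset by blast
    have "{A \<in> F. odd (card (nb v \<inter> A))} = {A \<in> Pow D. odd (card (nb v \<inter> A))}"
      by (auto simp: F_def)
    then show ?thesis
      using odd_nb_half [of "Pow D" "{d}" v] d finite_D
      by (auto simp: toggle_closed_def card_Pow)
  qed
  have "(\<Sum>v\<in>I. card {A \<in> F. odd (card (nb v \<inter> A))}) \<le> f * card F"
    using averaging [of F I "{}"] private_in by (auto simp: F_def)
  then have "(\<Sum>v\<in>I. 2 * card {A \<in> F. odd (card (nb v \<inter> A))}) \<le> 2 * (f * card F)"
    by (simp add: sum_distrib_left [symmetric])
  then show ?thesis
    using half cF by simp
qed

section \<open>Vertices of the dominating set without an odd coupling\<close>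

text \<open>A largest \<open>U\<close> satisfying the invariant \<open>good\<close> replaces the
  greedy procedure. The bound \<open>4 \<le> card (nb u)\<close> later separates \<open>U\<close>
  from the private neighbours and from the vertices defining pairs, which have only 1 and 2
  neighbours in \<open>D\<close>.\<close>

lemma greedy_cover:
  assumes B: "B \<subseteq> D"
  obtains U C where "U \<subseteq> I" "C = B \<inter> (\<Union>u\<in>U. nb u)" "4 * card U \<le> card C"
    "\<And>u. u \<in> U \<Longrightarrow> 4 \<le> card (nb u)"
    "\<And>d. d \<in> C \<Longrightarrow> \<exists>a\<in>C - {d}. card {u \<in> U. adj d u \<and> adj a u} = 1"
    "\<And>v. v \<in> I \<Longrightarrow> card (nb v \<inter> (B - C)) \<le> 3"
proof -
  define cov where "cov U = B \<inter> (\<Union>u\<in>U. nb u)" for U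
  define good where "good U \<longleftrightarrow> U \<subseteq> I \<and> 4 * card U \<le> card (cov U) \<and> (\<forall>u\<in>U. 4 \<le> card (nb u)) \<and>
    (\<forall>d\<in>cov U. \<exists>a\<in>cov U - {d}. card {u \<in> U. adj d u \<and> adj a u} = 1)" for U
  have finB: "finite B"
    using B finite_D finite_subset by auto
  have "good {}"
    by (simp add: good_def cov_def)
  moreover have "\<forall>U. good U \<longrightarrow> card U < Suc (card I)"
    using card_mono [OF finite_I] by (auto simp: good_def less_Suc_eq_le)
  ultimately obtain U where U: "good U" and maxU: "\<And>V. good V \<Longrightarrow> card V \<le> card U"
    using ex_has_greatest_nat [of good "{}" card] by blast
  have UI: "U \<subseteq> I"
    using U by (simp add: good_def)
  then have finU: "finite U"
    using finite_I finite_subset by auto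
  have "card (nb v \<inter> (B - cov U)) \<le> 3" if v: "v \<in> I" for v
  proof (rule ccontr)
    define N where "N = nb v \<inter> (B - cov U)"
    assume "\<not> card (nb v \<inter> (B - cov U)) \<le> 3"
    then have N4: "4 \<le> card N"
      by (simp add: N_def)
    have finN: "finite N"
      using finB by (auto simp: N_def)
    have vU: "v \<notin> U"
    proof
      assume "v \<in> U"
      then have "N = {}"
        by (auto simp: N_def cov_def)
      with N4 show False
        by simp
    qed
    have cov': "cov (insert v U) = cov U \<union> (nb v \<inter> B)"
      by (auto simp: cov_def)
    have "card (cov U \<union> N) = card (cov U) + card N"
      using finB by (intro card_Un_disjoint) (auto simp: N_def cov_def)
    moreover have "card (cov U \<union> N) \<le> card (cov (insert v U))"
      using finB unfolding cov' by (intro card_mono) (auto simp: N_def cov_def)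
    ultimately have "4 * card (insert v U) \<le> card (cov (insert v U))"
      using N4 U finU vU by (simp add: good_def)
    moreover have "4 \<le> card (nb v)"
      using N4 card_mono [OF finite_nb [of v], of N] by (auto simp: N_def)
    moreover have "\<exists>a\<in>cov (insert v U) - {d}. card {u \<in> insert v U. adj d u \<and> adj a u} = 1"
      if d: "d \<in> cov (insert v U)" for d
    proof -
      have dD: "d \<in> D"
        using d B by (auto simp: cov_def)
      show ?thesis
      proof (cases "d \<in> nb v")
        case True
        \<comment> \<open>The partner of \<open>d\<close> is another newly covered vertex
          \<open>a\<close>: no member of \<open>U\<close> is adjacent to it, so \<open>v\<close> is
          the only common neighbour.\<close>
        have "\<not> N \<subseteq> {d}"
          using N4 card_mono [of "{d}" N] by auto
        then obtain a where a: "a \<in> N" "a \<noteq> d"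
          by auto
        then have aD: "a \<in> D" "a \<in> nb v" "a \<in> B" "a \<notin> cov U"
          using B by (auto simp: N_def)
        have "u = v" if "u \<in> insert v U" "adj a u" for u
          using that aD in_nb_iff [of a u] by (auto simp: cov_def)
        then have "{u \<in> insert v U. adj d u \<and> adj a u} = {v}"
          using True aD in_nb_iff dD by auto
        then show ?thesis
          using a by (intro bexI [of _ a]) (auto simp: cov' N_def)
      next
        case False
        then have "d \<in> cov U"
          using d by (auto simp: cov')
        then obtain a where a: "a \<in> cov U - {d}" "card {u \<in> U. adj d u \<and> adj a u} = 1"
          using U unfolding good_def by blast
        \<comment> \<open>As \<open>v\<close> is not adjacent to \<open>d\<close>, the old partner
          still works.\<close>
        moreover have "{u \<in> insert v U. adj d u \<and> adj a u} = {u \<in> U. adj d u \<and> adj a u}"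
          using False in_nb_iff [OF dD] by auto
        ultimately show ?thesis
          by (intro bexI [of _ a]) (auto simp: cov')
      qed
    qed
    ultimately have "good (insert v U)"
      using U v by (auto simp: good_def)
    then show False
      using maxU [of "insert v U"] vU finU by simp
  qed
  with U show ?thesis
    by (intro that [of U "cov U"]) (auto simp: good_def cov_def)
qed

lemma pair_packing:
  assumes B: "B \<subseteq> D"
  obtains P W where "finite P" "\<And>e. e \<in> P \<Longrightarrow> card e = 2 \<and> (\<exists>v\<in>I. nb v = e)" "disjoint P"
    "\<Union>P \<subseteq> B" "W = B - \<Union>P" "card B = card W + 2 * card P"
    "\<And>v. v \<in> I \<Longrightarrow> nb v \<subseteq> W \<Longrightarrow> card (nb v) \<noteq> 2"
proof -
  define E where "E = {e. e \<subseteq> B \<and> card e = 2 \<and> (\<exists>v\<in>I. nb v = e)}"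
  define good where "good P \<longleftrightarrow> P \<subseteq> E \<and> disjoint P" for P
  have finB: "finite B"
    using B finite_D finite_subset by auto
  then have finE: "finite E"
    by (auto simp: E_def intro: finite_subset [of _ "Pow B"])
  have "good {}"
    by (simp add: good_def)
  moreover have "\<forall>P. good P \<longrightarrow> card P < Suc (card E)"
    using card_mono [OF finE] by (auto simp: good_def less_Suc_eq_le)
  ultimately obtain P where P: "good P" and maxP: "\<And>Q. good Q \<Longrightarrow> card Q \<le> card P"
    using ex_has_greatest_nat [of good "{}" card] by blast
  have finP: "finite P"
    using P finE finite_subset by (auto simp: good_def)
  have PB: "\<Union>P \<subseteq> B"
    using P by (auto simp: good_def E_def)
  have "card (\<Union>P) = (\<Sum>e\<in>P. card e)"
    using P finB finite_subset
    by (intro card_Union_disjoint) (auto simp: good_def E_def)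
  also have "\<dots> = (\<Sum>e\<in>P. 2)"
    using P by (intro sum.cong) (auto simp: good_def E_def)
  finally have "card (\<Union>P) = 2 * card P"
    by simp
  moreover have "card (B - \<Union>P) = card B - card (\<Union>P)" "card (\<Union>P) \<le> card B"
    using PB finB by (auto intro: card_mono card_Diff_subset finite_subset)
  ultimately have card: "card B = card (B - \<Union>P) + 2 * card P"
    by simp
  have "card (nb v) \<noteq> 2" if v: "v \<in> I" "nb v \<subseteq> B - \<Union>P" for v
  proof
    assume 2: "card (nb v) = 2"
    \<comment> \<open>The neighbourhood is nonempty and misses the union of \<open>P\<close>, so
      inserting it would strictly enlarge the packing.\<close>
    have "nb v \<notin> P"
      using v nb_nonempty by blast
    moreover have "good (insert (nb v) P)"
      using P v 2 by (auto simp: good_def E_def disjoint_def disjnt_def pairwise_insert)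
    ultimately show False
      using maxP finP by fastforce
  qed
  then show ?thesis
    using P PB finP card by (intro that [of P "B - \<Union>P"]) (auto simp: good_def E_def)
qed

text \<open>The same \<open>U\<close> and \<open>C\<close> serve two averages, one gaining from
  \<open>W\<close> and one from \<open>P\<close>; a weighted sum of the two bounds gives the
  claim.\<close>

lemma uncoupled_bound:
  assumes B: "B \<subseteq> D" and uncoupled: "\<And>d a. d \<in> B \<Longrightarrow> a \<in> D - {d} \<Longrightarrow> even (coupling I d a)"
  shows "4 * card I + card B \<le> 8 * f"
proof -
  obtain U C where U: "U \<subseteq> I" and C: "C = B \<inter> (\<Union>u\<in>U. nb u)" and UC: "4 * card U \<le> card C"
    and U4: "\<And>u. u \<in> U \<Longrightarrow> 4 \<le> card (nb u)"
    and C1: "\<And>d. d \<in> C \<Longrightarrow> \<exists>a\<in>C - {d}. card {u \<in> U. adj d u \<and> adj a u} = 1"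
    and I3: "\<And>v. v \<in> I \<Longrightarrow> card (nb v \<inter> (B - C)) \<le> 3"
    by (rule greedy_cover [OF B]) blast
  have "B - C \<subseteq> D"
    using B by auto
  then obtain P W where finP: "finite P" and P2: "\<And>e. e \<in> P \<Longrightarrow> card e = 2 \<and> (\<exists>v\<in>I. nb v = e)"
    and disjP: "disjoint P" and PB: "\<Union>P \<subseteq> B - C" and W: "W = B - C - \<Union>P"
    and card_BC: "card (B - C) = card W + 2 * card P"
    and W2: "\<And>v. v \<in> I \<Longrightarrow> nb v \<subseteq> W \<Longrightarrow> card (nb v) \<noteq> 2"
    by (rule pair_packing) blast
  have CB: "C \<subseteq> B" and CD: "C \<subseteq> D" and WD: "W \<subseteq> D" and finB: "finite B"
    using B C W finite_subset [OF _ finite_D] by auto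
  have finU: "finite U"
    using U finite_I by (rule finite_subset)
  have Up: "U \<inter> p ` D = {}"
  proof -
    have "card (nb (p d)) = 1" if "d \<in> D" for d
      using that nb_private by simp
    then show ?thesis
      using U4 by fastforce
  qed
  \<comment> \<open>Deleting \<open>U\<close> removes exactly one common neighbour of
    \<open>d\<close> and its partner \<open>a\<close>, so the even coupling becomes odd.\<close>
  have coupled: "\<exists>a\<in>C - {d}. odd (coupling (I - U) d a)" if d: "d \<in> C" for d
  proof -
    obtain a where a: "a \<in> C - {d}" "card {u \<in> U. adj d u \<and> adj a u} = 1"
      using C1 [OF d] by auto
    have "{v \<in> I. adj d v \<and> adj a v}
        = {v \<in> I - U. adj d v \<and> adj a v} \<union> {u \<in> U. adj d u \<and> adj a u}"
      using U by auto
    moreover have "card ({v \<in> I - U. adj d v \<and> adj a v} \<union> {u \<in> U. adj d u \<and> adj a u})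
        = card {v \<in> I - U. adj d v \<and> adj a v} + card {u \<in> U. adj d u \<and> adj a u}"
      using finite_I finU by (intro card_Un_disjoint) auto
    ultimately have "coupling I d a = coupling (I - U) d a + 1"
      using a(2) by (simp add: coupling_def)
    moreover have "even (coupling I d a)"
      using uncoupled [of d a] d a CB CD by auto
    ultimately show ?thesis
      using a by auto
  qed
  \<comment> \<open>First average: \<open>A\<close> contains \<open>W\<close>, so the private
    neighbours of \<open>W\<close> are always odd.\<close>
  have "2 * card I + 2 * card (p ` W) + card C \<le> 4 * f + 2 * card U"
  proof (rule averaging_bound [where F = "{A. A \<subseteq> D \<and> W \<subseteq> A}"])
    let ?F = "{A. A \<subseteq> D \<and> W \<subseteq> A}"
    have cl: "toggle_closed ?F {d}" if "d \<in> D - W" for d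
      using that by (auto simp: toggle_closed_def)
    show "?F \<subseteq> Pow D" "?F \<noteq> {}"
      using WD by auto
    show "toggle_closed ?F {d} \<and>
        (\<exists>a\<in>D - {d}. toggle_closed ?F {a} \<and> odd (coupling (I - U) d a))" if d: "d \<in> C" for d
    proof -
      obtain a where "a \<in> C - {d}" "odd (coupling (I - U) d a)"
        using coupled [OF d] by auto
      then show ?thesis
        using d CD W cl by (intro conjI bexI [of _ a]) auto
    qed
    \<comment> \<open>A neighbourhood inside \<open>W\<close> has 1 or 3 elements, hence is odd for
      every \<open>A\<close>; any other one contains a point outside \<open>W\<close> that can be
      toggled.\<close>
    show "card ?F \<le> 2 * card {A \<in> ?F. odd (card (nb v \<inter> A))}" if v: "v \<in> I" for v
    proof (cases "nb v \<subseteq> W")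
      case True
      then have "nb v \<inter> (B - C) = nb v"
        using W by auto
      then have "card (nb v) \<le> 3"
        using I3 [OF v] by simp
      moreover have "card (nb v) \<noteq> 0"
        using nb_nonempty [OF v] finite_nb by simp
      moreover have "card (nb v) \<noteq> 2"
        using W2 [OF v True] .
      ultimately have "card (nb v) = 1 \<or> card (nb v) = 3"
        by linarith
      then have "odd (card (nb v))"
        by auto
      moreover have "nb v \<inter> A = nb v" if "A \<in> ?F" for A
        using that True by auto
      ultimately have "{A \<in> ?F. odd (card (nb v \<inter> A))} = ?F"
        by auto
      then show ?thesis
        by simp
    next
      case False
      then obtain x where "x \<in> nb v" "x \<in> D - W"
        using nb_subset by auto
      then have "2 * card {A \<in> ?F. odd (card (nb v \<inter> A))} = card ?F"
        using cl by (intro odd_nb_half [where T = "{x}"]) auto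
      then show ?thesis
        by simp
    qed
    show "p ` W \<subseteq> I - U"
      using Up WD private_in by auto
    show "odd (card (nb v \<inter> A))" if v: "v \<in> p ` W" and A: "A \<in> ?F" for v A
    proof -
      obtain d where "d \<in> W" "v = p d"
        using v by auto
      then have "nb v \<inter> A = {d}"
        using A WD nb_private by auto
      then show ?thesis
        by simp
    qed
  qed (use U Up CD in auto)
  moreover have "card (p ` W) = card W"
    using inj_private WD by (intro card_image) (rule inj_on_subset)
  ultimately have bound_W: "2 * card I + 2 * card W + card C \<le> 4 * f + 2 * card U"
    by simp
  obtain r where r: "\<And>e. e \<in> P \<Longrightarrow> r e \<in> I \<and> nb (r e) = e"
    using P2 by metis
  \<comment> \<open>Second average: \<open>A\<close> meets each pair of \<open>P\<close> in exactly
    one point, so the representatives \<open>r e\<close> are always odd.\<close>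
  have "2 * card I + 2 * card (r ` P) + card C \<le> 4 * f + 2 * card U"
  proof (rule averaging_bound [where F = "{A. A \<subseteq> D \<and> (\<forall>e\<in>P. odd (card (A \<inter> e)))}"])
    let ?F = "{A. A \<subseteq> D \<and> (\<forall>e\<in>P. odd (card (A \<inter> e)))}"
    have PD: "e \<subseteq> D" if "e \<in> P" for e
      using that PB B by auto
    have cl: "toggle_closed ?F T" if T: "T \<subseteq> D" "\<And>e. e \<in> P \<Longrightarrow> even (card (T \<inter> e))" for T
      unfolding toggle_closed_def
    proof
      fix A assume A: "A \<in> ?F"
      have fin: "finite A" "finite T"
        using A T finite_D finite_subset by auto
      have "odd (card (sym_diff A T \<inter> e))" if e: "e \<in> P" for e
      proof -
        have "sym_diff A T \<inter> e = sym_diff (A \<inter> e) (T \<inter> e)"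
          by auto
        then show ?thesis
          using even_card_sym_diff [of "A \<inter> e" "T \<inter> e"] fin A T e by auto
      qed
      then show "sym_diff A T \<in> ?F"
        using A T by auto
    qed
    have cl1: "toggle_closed ?F {d}" if d: "d \<in> D - \<Union>P" for d
    proof (rule cl)
      show "even (card ({d} \<inter> e))" if "e \<in> P" for e
      proof -
        have "{d} \<inter> e = {}"
          using that d by auto
        then show ?thesis
          by simp
      qed
    qed (use d in auto)
    show "?F \<subseteq> Pow D"
      by auto
    show "?F \<noteq> {}"
    proof -
      \<comment> \<open>Choosing one point from each pair gives a member of the family; disjointness
        keeps the choices from interfering.\<close>
      define s where "s e = (SOME x. x \<in> e)" for e :: "'a set"
      have s: "s e \<in> e" if "e \<in> P" for e
      proof -
        have "e \<noteq> {}"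
          using P2 [OF that] by auto
        then show ?thesis
          by (simp add: s_def some_in_eq)
      qed
      have "s ` P \<inter> e = {s e}" if e: "e \<in> P" for e
      proof -
        have "x = s e" if x: "x \<in> s ` P" "x \<in> e" for x
        proof -
          obtain e' where e': "e' \<in> P" "x = s e'"
            using x by auto
          then have "x \<in> e \<inter> e'"
            using x s by auto
          then have "e' = e"
            using disjointD [OF disjP e e'(1)] by blast
          with e' show ?thesis
            by simp
        qed
        then show ?thesis
          using s e by auto
      qed
      moreover have "s ` P \<subseteq> D"
        using s PD by blast
      ultimately have "s ` P \<in> ?F"
        by simp
      then show ?thesis
        by blast
    qed
    show "toggle_closed ?F {d} \<and>
        (\<exists>a\<in>D - {d}. toggle_closed ?F {a} \<and> odd (coupling (I - U) d a))" if d: "d \<in> C" for d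
    proof -
      obtain a where "a \<in> C - {d}" "odd (coupling (I - U) d a)"
        using coupled [OF d] by auto
      then show ?thesis
        using d CD PB by (intro conjI bexI [of _ a] cl1) auto
    qed
    have rep_odd: "odd (card (nb v \<inter> A))" if "nb v \<in> P" "A \<in> ?F" for v A
      using that by (auto simp: Int_commute)
    show "card ?F \<le> 2 * card {A \<in> ?F. odd (card (nb v \<inter> A))}" if v: "v \<in> I" for v
    proof (cases "nb v \<in> P")
      case True
      then have "{A \<in> ?F. odd (card (nb v \<inter> A))} = ?F"
        using rep_odd by blast
      then show ?thesis
        by simp
    next
      case False
      \<comment> \<open>A point of \<open>nb v\<close> outside all pairs can be toggled alone.
        Otherwise a whole pair is toggled: if this never works, every pair meeting
        \<open>nb v\<close> lies inside it, and as \<open>nb v\<close> is not itself in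
        \<open>P\<close> it contains two pairs, against \<open>card (nb v) \<le> 3\<close>.\<close>
      have "\<exists>T. toggle_closed ?F T \<and> finite T \<and> odd (card (nb v \<inter> T))"
      proof (cases "nb v \<subseteq> \<Union>P")
        case nbP: True
        then have "nb v \<inter> (B - C) = nb v"
          using PB by auto
        then have le3: "card (nb v) \<le> 3"
          using I3 [OF v] by simp
        show ?thesis
        proof (rule ccontr)
          assume no_T: "\<not> ?thesis"
          have sub: "e \<subseteq> nb v" if e: "e \<in> P" "e \<inter> nb v \<noteq> {}" for e
          proof -
            have fin: "finite e"
              using PD [OF e(1)] finite_D finite_subset by auto
            have "toggle_closed ?F e"
            proof (rule cl)
              show "even (card (e \<inter> e'))" if "e' \<in> P" for e'
                using that e(1) disjP P2 [OF e(1)] by (cases "e = e'") (auto simp: disjoint_def)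
            qed (use PD e in auto)
            with no_T fin have "even (card (nb v \<inter> e))"
              by auto
            moreover have "card (nb v \<inter> e) \<noteq> 0"
              using e(2) fin by auto
            moreover have "card (nb v \<inter> e) \<le> 2"
              using card_mono [OF fin, of "nb v \<inter> e"] P2 [OF e(1)] by auto
            ultimately have "card (nb v \<inter> e) = card e"
              using P2 [OF e(1)] by (auto elim!: evenE)
            then have "nb v \<inter> e = e"
              using fin by (intro card_subset_eq) auto
            then show ?thesis
              by auto
          qed
          obtain x where "x \<in> nb v"
            using nb_nonempty [OF v] by auto
          then obtain e where e: "e \<in> P" "x \<in> e"
            using nbP by auto
          have esub: "e \<subseteq> nb v"
            using sub e \<open>x \<in> nb v\<close> by auto
          moreover have "nb v \<noteq> e"
            using e False by auto
          ultimately obtain y where y: "y \<in> nb v" "y \<notin> e"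
            by blast
          then obtain e' where e': "e' \<in> P" "y \<in> e'"
            using nbP by auto
          have "e' \<subseteq> nb v"
            using sub e' y by auto
          with esub have "card (e \<union> e') \<le> card (nb v)"
            using finite_nb by (intro card_mono) auto
          moreover have "card (e \<union> e') = card e + card e'"
          proof (rule card_Un_disjoint)
            show "finite e" "finite e'"
              using PD e e' finite_subset [OF _ finite_D] by auto
            show "e \<inter> e' = {}"
              using disjointD [OF disjP e(1) e'(1)] e' y by auto
          qed
          ultimately show False
            using le3 P2 [OF e(1)] P2 [OF e'(1)] by simp
        qed
      next
        case False
        then obtain x where "x \<in> nb v" "x \<in> D - \<Union>P"
          using nb_subset [of v] by blast
        then show ?thesis
          using cl1 by (intro exI [of _ "{x}"]) auto
      qed
      then obtain T where "toggle_closed ?F T" "finite T" "odd (card (nb v \<inter> T))"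
        by blast
      then have "2 * card {A \<in> ?F. odd (card (nb v \<inter> A))} = card ?F"
        by (intro odd_nb_half) auto
      then show ?thesis
        by simp
    qed
    show "r ` P \<subseteq> I - U"
    proof
      fix v assume "v \<in> r ` P"
      then have "v \<in> I" "card (nb v) = 2"
        using r P2 by auto
      then show "v \<in> I - U"
        using U4 by force
    qed
    show "odd (card (nb v \<inter> A))" if "v \<in> r ` P" "A \<in> ?F" for v A
      using that r by (intro rep_odd) auto
  qed (use U Up CD in auto)
  moreover have "card (r ` P) = card P"
    using r by (intro card_image) (metis inj_onI)
  ultimately have bound_P: "2 * card I + 2 * card P + card C \<le> 4 * f + 2 * card U"
    by simp
  have "card (B - C) = card B - card C" "card C \<le> card B"
    using CB finB finite_subset by (auto intro: card_Diff_subset card_mono)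
  then show ?thesis
    \<comment> \<open>Take \<open>bound_W\<close> plus twice \<open>bound_P\<close>, so that
      \<open>W\<close> and the points of the pairs get equal weight. The deletion cost
      \<open>6 * card U\<close> is at most \<open>3/2 * card C\<close>; what remains of
      \<open>C\<close> is exactly enough, whence the constant 4 in the cover.\<close>
    using bound_W bound_P UC card_BC by linarith
qed

lemma many_dominators_bound: "6 * card I + card D \<le> 12 * f"
proof -
  define X where "X = {d \<in> D. \<exists>a\<in>D - {d}. odd (coupling I d a)}"
  have "2 * card I + card X \<le> 4 * f"
    unfolding X_def by (rule coupled_bound)
  moreover have "4 * card I + card (D - X) \<le> 8 * f"
    by (rule uncoupled_bound) (auto simp: X_def)
  moreover have "card (D - X) = card D - card X" "card X \<le> card D"
    using finite_D by (auto simp: X_def intro!: card_Diff_subset card_mono)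
  ultimately show ?thesis
    by linarith
qed

end

section \<open>Numerical comparison with the logarithmic bound\<close>

text \<open>With \<open>x = log\<^sub>3 \<surd>a\<close> the required gain over \<open>a / 2\<close> is \<open>(x - log\<^sub>3 x) / 4\<close>. For \<open>x \<le> 3\<close> it is at
  most \<open>1 / 2\<close>, which follows from \<open>a < 2 f\<close> by integrality. For \<open>x > 3\<close>, either \<open>many\<close> suffices or
  \<open>k < 3 x - 3\<close>, and then \<open>few\<close> does because \<open>2 ^ k < 8\<^sup>x / 8\<close> is small against \<open>a = 9\<^sup>x\<close>.\<close>

lemma log_bound_of_dominators:
  fixes a f k :: nat
  assumes a: "2 \<le> a" and k: "1 \<le> k" and many: "6 * a + k \<le> 12 * f"
    and few: "a * 2 ^ k \<le> 2 * f * (2 ^ k - 1)"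
  shows "real a / 2 + log 3 (real a) / 8 - log 3 (log 3 (sqrt (real a))) / 4 \<le> real f"
proof -
  define x where "x = log 3 (sqrt (real a))"
  have log_a: "log 3 (real a) = 2 * x"
    using a by (simp add: x_def log_def ln_sqrt)
  have a_eq: "real a = 9 powr x"
  proof -
    have "real a = 3 powr (2 * x)"
      using a by (simp flip: log_a)
    also have "\<dots> = (3 powr 2) powr x"
      by (simp only: powr_powr)
    finally show ?thesis
      by simp
  qed
  have x_pos: "x > 0"
    using a by (simp add: x_def)
  have ln3: "0 < ln (3::real)"
    by simp
  have goal: ?thesis if "(x - log 3 x) / 4 \<le> real f - real a / 2"
    using that log_a by (simp add: x_def [symmetric] field_simps)
  show ?thesis
  proof (cases "x \<le> 3")
    case True
    have "- log 3 x \<le> 2 - x"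
    proof (cases "1 \<le> x")
      case ge1: True
      have "1 \<le> ln (3::real)"
        using exp_le by (subst ln_ge_iff) auto
      then have "1 * 1 \<le> x * ln 3"
        using ge1 by (intro mult_mono) auto
      \<comment> \<open>The tangent of \<open>ln\<close> at 1, applied to \<open>3 / x\<close>. With
        \<open>x * ln 3 \<ge> 1\<close> it yields \<open>1 - log 3 x \<le> 3 - x\<close>.\<close>
      have "ln 3 - ln x \<le> 3 / x - 1"
        using ln_le_minus_one [of "3 / x"] x_pos by (simp add: ln_div)
      also have "\<dots> = (3 - x) * 1 / x"
        using x_pos by (simp add: field_simps)
      also have "\<dots> \<le> (3 - x) * (x * ln 3) / x"
        using True x_pos \<open>1 * 1 \<le> x * ln 3\<close>
        by (intro divide_right_mono mult_left_mono) auto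
      also have "\<dots> = (3 - x) * ln 3"
        using x_pos by simp
      finally show ?thesis
        using ln3 by (simp add: log_def field_simps)
    next
      case lt1: False
      \<comment> \<open>From \<open>16 \<le> 27\<close>, \<open>log 3 2 \<le> 3/4\<close>. Hence
        \<open>- log 3 x\<close> is at most 1 on [1/2, 1) and at most 3/2 on [1/4, 1/2), which is
        below \<open>2 - x\<close> in both ranges.\<close>
      have "log 3 (2 ^ 4) \<le> log 3 (3 ^ 3)" "log 3 2 \<le> log 3 (3::real)"
        by (simp_all add: log_le_cancel_iff del: log_pow_cancel)
      then have log2: "4 * log 3 2 \<le> (3::real)" "log 3 2 \<le> (1::real)"
        by (simp_all add: log_nat_power del: power_numeral)
      \<comment> \<open>As the square root of 3 is at most \<open>a\<close>, no \<open>x\<close>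
        below 1/4 occurs.\<close>
      have "log 3 (3 powr (1/2)) \<le> log 3 (real a)"
      proof (subst log_le_cancel_iff)
        have "sqrt 3 \<le> sqrt (2 ^ 2)"
          by (subst real_sqrt_le_iff) simp
        then show "3 powr (1/2) \<le> real a"
          using a by (simp add: powr_half_sqrt)
      qed (use a in auto)
      then have "1 / 4 \<le> x"
        using log_a by simp
      show ?thesis
      proof (cases "1 / 2 \<le> x")
        case True
        then have "log 3 (1 / 2) \<le> log 3 x"
          using x_pos by (subst log_le_cancel_iff) auto
        with log2 lt1 show ?thesis
          by (simp add: log_divide)
      next
        case False
        have "log 3 (1 / 2 ^ 2) \<le> log 3 x"
          using x_pos \<open>1 / 4 \<le> x\<close> by (subst log_le_cancel_iff) auto
        then have "- (2 * log 3 2) \<le> log 3 x"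
          by (simp add: log_divide log_nat_power del: power_numeral)
        with log2 False show ?thesis
          by simp
      qed
    qed
    moreover have "a + 1 \<le> 2 * f"
      using many k by linarith
    then have "real a + 1 \<le> 2 * real f"
      by linarith
    ultimately show ?thesis
      by (intro goal) (simp add: field_simps)
  next
    case False
    have log_x: "1 \<le> log 3 x"
      using False by simp
    show ?thesis
    proof (cases "3 * (x - log 3 x) \<le> real k")
      case True
      have "6 * real a + real k \<le> 12 * real f"
        using many by linarith
      with True show ?thesis
        by (intro goal) (simp add: field_simps)
    next
      case few_k: False
      define y where "y = (2::real) powr real k"
      have y_pos: "0 < y"
        by (simp add: y_def)
      have "y \<le> 2 powr (3 * x - 3)"
        unfolding y_def using few_k log_x by (intro powr_mono) auto
      also have "\<dots> = 8 powr x / 8"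
        using powr_powr [of 2 3 x] by (simp add: powr_diff)
      finally have y_le: "8 * y \<le> 8 powr x"
        by simp
      \<comment> \<open>This is \<open>ln (9/8) \<ge> 1/9\<close>, so \<open>9 powr x\<close>
        exceeds \<open>8 powr x\<close> by a factor of at least \<open>x / 9\<close>; with
        \<open>8 * y \<le> 8 powr x\<close> this leaves \<open>8/9 * x * y \<le> a\<close>, and 1/2
        in place of 8/9 suffices.\<close>
      have "1 - inverse (9/8) \<le> ln (9/8 :: real)"
        using ln_le_minus_one [of "inverse (9/8) :: real"] by (simp add: ln_div ln_inverse)
      then have "x / 9 \<le> x * ln (9/8)"
        using x_pos by simp
      also have "\<dots> \<le> (9/8) powr x"
        using order_trans [OF _ exp_ge_add_one_self, of "x * ln (9/8)" "x * ln (9/8)"]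
        by (simp add: powr_def)
      also have "\<dots> = 9 powr x / 8 powr x"
        by (simp add: powr_divide)
      finally have "x / 9 * 8 powr x \<le> real a"
        using a_eq by (simp add: field_simps)
      moreover have "x / 9 * (8 * y) \<le> x / 9 * 8 powr x"
        using y_le x_pos by (intro mult_left_mono) auto
      ultimately have "x * y / 2 \<le> real a"
        using x_pos y_pos mult_pos_pos [OF x_pos y_pos] by linarith
      moreover have "real a * y \<le> 2 * real f * (y - 1)"
      proof -
        have "real (a * 2 ^ k) \<le> real (2 * f * (2 ^ k - 1))"
          using few by (rule of_nat_mono)
        then show ?thesis
          by (simp add: y_def powr_realpow of_nat_diff)
      qed
      moreover have "real a \<le> 2 * real f"
        using many by linarith
      \<comment> \<open>The bound \<open>few\<close> reads
        \<open>2 * f \<le> (2 * f - a) * y\<close>, and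
        \<open>x * y / 2 \<le> a \<le> 2 * f\<close>.\<close>
      ultimately have "x / 2 * y \<le> (2 * real f - real a) * y"
        by (simp add: algebra_simps)
      then have "x / 2 \<le> 2 * real f - real a"
        using y_pos by (rule mult_right_le_imp_le)
      with log_x show ?thesis
        by (intro goal) (simp add: field_simps)
    qed
  qed
qed

section \<open>Minimal dominating sets and transfer to graphs\<close>

text \<open>In a dominating set of least size, removing \<open>d\<close> leaves some
  \<open>v\<close> in \<open>I\<close> undominated; then \<open>d\<close> is the only dominator of
  \<open>v\<close>, and \<open>v\<close> serves as \<open>p d\<close>.\<close>

lemma exists_private_dominating_set:
  assumes V: "finite V" and dom: "\<And>v. v \<in> I \<Longrightarrow> \<exists>d\<in>V. R v d"
  obtains D p where "D \<subseteq> V" "\<And>v. v \<in> I \<Longrightarrow> \<exists>d\<in>D. R v d"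
    "\<And>d. d \<in> D \<Longrightarrow> p d \<in> I \<and> {x \<in> D. R (p d) x} = {d}"
proof -
  have "finite V \<and> (\<forall>v\<in>I. \<exists>d\<in>V. R v d)"
    using assms by auto
  then obtain D where "finite D \<and> D \<subseteq> V \<and> (\<forall>v\<in>I. \<exists>d\<in>D. R v d)"
    and min: "\<And>E. finite E \<and> E \<subseteq> V \<and> (\<forall>v\<in>I. \<exists>d\<in>E. R v d) \<Longrightarrow> card D \<le> card E"
    using ex_has_least_nat [of "\<lambda>E. finite E \<and> E \<subseteq> V \<and> (\<forall>v\<in>I. \<exists>d\<in>E. R v d)" V card] by blast
  then have D: "finite D" "D \<subseteq> V" "\<forall>v\<in>I. \<exists>d\<in>D. R v d"
    by auto
  have "\<exists>v\<in>I. {x \<in> D. R v x} = {d}" if d: "d \<in> D" for d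
  proof -
    have "card (D - {d}) < card D"
      using D(1) d by (rule card_Diff1_less)
    moreover have "D - {d} \<subseteq> V"
      using D(2) by blast
    ultimately have "\<not> (\<forall>v\<in>I. \<exists>e\<in>D - {d}. R v e)"
      using min [of "D - {d}"] D(1) by auto
    then obtain v where v: "v \<in> I" "\<forall>e\<in>D - {d}. \<not> R v e"
      by blast
    with D(3) have "{x \<in> D. R v x} = {d}"
      by fastforce
    with v show ?thesis
      by blast
  qed
  then have "\<forall>d\<in>D. \<exists>v. v \<in> I \<and> {x \<in> D. R v x} = {d}"
    by blast
  then obtain p where "\<forall>d\<in>D. p d \<in> I \<and> {x \<in> D. R (p d) x} = {d}"
    by (auto dest: bchoice)
  with D that show ?thesis
    by blast
qed

text \<open>Without parallel arcs, an arc leaving \<open>v\<close> is determined by its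
  head.\<close>

lemma out_degree_induce_subgraph:
  assumes "graph G" and v: "v \<in> S"
  shows "out_degree (G \<restriction> S) v = card {w \<in> S. v \<rightarrow>\<^bsub>G\<^esub> w}"
proof -
  interpret graph G by fact
  have "bij_betw (head G) (out_arcs (G \<restriction> S) v) {w \<in> S. v \<rightarrow>\<^bsub>G\<^esub> w}"
    unfolding bij_betw_def
  proof
    show "inj_on (head G) (out_arcs (G \<restriction> S) v)"
      by (rule inj_onI) (auto simp: out_arcs_def arc_to_ends_def intro: no_multi_arcs)
    show "head G ` out_arcs (G \<restriction> S) v = {w \<in> S. v \<rightarrow>\<^bsub>G\<^esub> w}"
      using v by (force simp: out_arcs_def arcs_ends_def arc_to_ends_def)
  qed
  then show ?thesis
    unfolding out_degree_def by (rule bij_betw_same_card)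
qed

lemma card_le_f_odd:
  assumes "graph G" and S: "S \<subseteq> verts G"
    and odd: "\<And>v. v \<in> S \<Longrightarrow> odd (card {w \<in> S. v \<rightarrow>\<^bsub>G\<^esub> w})"
  shows "card S \<le> f_odd G"
proof -
  interpret graph G by fact
  have "{card S |S. odd_induced G S} \<subseteq> card ` Pow (verts G)"
    by (auto simp: odd_induced_def)
  then have "finite {card S |S. odd_induced G S}"
    by (rule finite_subset) simp
  moreover have "odd_induced G S"
    using S odd out_degree_induce_subgraph [OF \<open>graph G\<close>] by (auto simp: odd_induced_def)
  ultimately show ?thesis
    unfolding f_odd_def by (intro Max_ge) auto
qed

lemma independence_number_attained:
  assumes "graph G"
  obtains I where "independent_set G I" "card I = independence_number G"
proof -
  interpret graph G by fact
  have "{card S |S. independent_set G S} \<subseteq> card ` Pow (verts G)"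
    by (auto simp: independent_set_def)
  then have "finite {card S |S. independent_set G S}"
    by (rule finite_subset) simp
  moreover have "independent_set G {}"
    by (simp add: independent_set_def)
  ultimately have "independence_number G \<in> {card S |S. independent_set G S}"
    unfolding independence_number_def by (intro Max_in) auto
  with that show ?thesis
    by auto
qed

lemma exists_neighbour:
  assumes "graph G" "min_degree G \<ge> 1" "v \<in> verts G"
  shows "\<exists>w\<in>verts G. v \<rightarrow>\<^bsub>G\<^esub> w"
proof -
  interpret graph G by fact
  have "min_degree G \<le> out_degree G v"
    unfolding min_degree_def using assms(3) by (intro Min_le) auto
  then have "out_arcs G v \<noteq> {}"
    using assms(2) by (auto simp: out_degree_def)
  then obtain e where "e \<in> arcs G" "tail G e = v"
    by (auto simp: out_arcs_def)
  then show ?thesis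
    by (intro bexI [of _ "head G e"]) (auto intro: in_arcs_imp_in_arcs_ends)
qed

theorem theorem28:
  fixes G :: "('a, 'b) pre_digraph"
  assumes "graph G"
    and "min_degree G \<ge> 1"
    and "independence_number G \<ge> 2"
  shows "real (f_odd G) \<ge> real (independence_number G) / 2
           + log 3 (real (independence_number G)) / 8
           - log 3 (log 3 (sqrt (real (independence_number G)))) / 4"
proof -
  interpret graph G by fact
  obtain I where I: "independent_set G I" and card_I: "card I = independence_number G"
    using independence_number_attained [OF assms(1)] .
  \<comment> \<open>The minimum degree supplies a neighbour, and independence puts it outside
    \<open>I\<close>.\<close>
  have "\<exists>d\<in>verts G - I. v \<rightarrow>\<^bsub>G\<^esub> d" if "v \<in> I" for v
    using exists_neighbour [OF assms(1,2), of v] I that by (auto simp: independent_set_def)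
  then obtain D p where D: "D \<subseteq> verts G - I" and dom: "\<And>v. v \<in> I \<Longrightarrow> \<exists>d\<in>D. v \<rightarrow>\<^bsub>G\<^esub> d"
    and p: "\<And>d. d \<in> D \<Longrightarrow> p d \<in> I \<and> {x \<in> D. p d \<rightarrow>\<^bsub>G\<^esub> x} = {d}"
    using exists_private_dominating_set [of "verts G - I" I "\<lambda>u v. u \<rightarrow>\<^bsub>G\<^esub> v"] by auto
  have fin: "finite D" "finite I"
    using D I by (auto simp: independent_set_def intro: finite_subset [OF _ finite_verts])
  interpret private_domination "\<lambda>u v. u \<rightarrow>\<^bsub>G\<^esub> v" D I p "f_odd G"
  proof
    show "u \<rightarrow>\<^bsub>G\<^esub> v \<Longrightarrow> v \<rightarrow>\<^bsub>G\<^esub> u" for u v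
      using sym_arcs by (rule arcs_ends_symmetric)
    show "card S \<le> f_odd G"
      if "S \<subseteq> D \<union> I" "\<And>v. v \<in> S \<Longrightarrow> odd (card {w \<in> S. v \<rightarrow>\<^bsub>G\<^esub> w})" for S
      using that D I by (intro card_le_f_odd [OF assms(1)]) (auto simp: independent_set_def)
  qed (use fin D I dom p in \<open>auto simp: independent_set_def\<close>)
  have "I \<noteq> {}"
    using card_I assms(3) by auto
  then have "D \<noteq> {}"
    using dom by auto
  then have "1 \<le> card D"
    using fin by (simp add: Suc_le_eq card_gt_0_iff)
  then show ?thesis
    using log_bound_of_dominators [of "card I" "card D" "f_odd G"] assms(3)
      many_dominators_bound few_dominators_bound [OF \<open>D \<noteq> {}\<close>] by (simp add: card_I)
qed

end
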